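(* Let $\mathbf{A}$ be a complex $n\times n$ matrix, let $\epsilon \ge 0$ and let $z\in\mathbb{C}$. Let $\Lambda_\epsilon(\mathbf{A})$ denote the $\epsilon$-pseudospectrum of $\mathbf{A}$. Then each of the following two conditions is equivalent to $z\in\Lambda_\epsilon(\mathbf{A})$: (v) there exist $\mathbf{v}_1,\mathbf{v}_2\in\mathbb{C}^n$ with $\|\mathbf{v}_1\|\le 1$ and $\|\mathbf{v}_2\|\le 1$ such that $z$ is in the spectrum of $\mathbf{A}+\epsilon\,\mathbf{v}_2\mathbf{v}_1^{*}$; (vi) there exists $\mathbf{v}\in\mathbb{C}^n$ with $\|\mathbf{v}\|\le 1$ and $\|\mathbf{A}\mathbf{v}-z\mathbf{v}\|\le\epsilon$ such that $z$ is in the spectrum of $\mathbf{A}-(\mathbf{A}\mathbf{v}-z\mathbf{v})\mathbf{v}^{*}$.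
   Context: $\|\cdot\|$ is the Euclidean 2-norm on $\mathbb{C}^n$, $\|\mathbf{v}\|^2=\mathbf{v}^*\mathbf{v}$, and the induced operator norm on matrices; $^*$ denotes conjugate transpose. The spectrum is the set of eigenvalues, denoted $\Lambda(\mathbf{A})$, and $\rho(\mathbf{A})=\mathbb{C}\setminus\Lambda(\mathbf{A})$ is the resolvent set. The $\epsilon$-pseudospectrum $\Lambda_\epsilon(\mathbf{A})$ is the set of $z\in\mathbb{C}$ satisfying any of the following (known to be equivalent) conditions: (i) the smallest singular value of $\mathbf{A}-z\mathbf{I}$ is at most $\epsilon$; (ii) there is $\mathbf{u}\in\mathbb{C}^n$ with $\|\mathbf{u}\|=1$ and $\|(\mathbf{A}-z\mathbf{I})\mathbf{u}\|^2\le\epsilon^2$; (iii) $z\in\Lambda(\mathbf{A})$, or $z\in\rho(\mathbf{A})$ and there is $\mathbf{u}\in\mathbb{C}^n$ with $\|\mathbf{u}\|=1$ and $\mathbf{u}^*\big((\mathbf{A}-z\mathbf{I})^{-1}\big)^*(\mathbf{A}-z\mathbf{I})^{-1}\mathbf{u}\ge 1/\epsilon^2$ (with $1/0=+\infty$); (iv) there is an $n\times n$ complex matrix $\mathbf{E}$ with $\|\mathbf{E}\|\le 1$ such that $z$ is in the spectrum of $\mathbf{A}+\epsilon\mathbf{E}$. *)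

theory Defs
  imports "HOL-Analysis.Analysis"
begin

text \<open>
  Complex \<open>n \<times> n\<close> matrices are elements of \<^typ>\<open>complex^'n^'n\<close>, with \<open>n = CARD('n)\<close>.  The library
  norm on \<^typ>\<open>complex^'n\<close> is the Euclidean norm, and \<open>onorm ((*v) E)\<close> is the operator norm it
  induces.  In contrast, the library norm on matrices is the Frobenius norm.
\<close>

definition spectrum :: "complex^'n^'n \<Rightarrow> complex set"
  where "spectrum A = {z. \<exists>x. x \<noteq> 0 \<and> A *v x = z *s x}"

definition cadjoint :: "complex^'n^'m \<Rightarrow> complex^'m^'n"
  where "cadjoint A = (\<chi> i j. cnj (A $ j $ i))"

text \<open>The rank-one matrix \<open>v w\<^sup>*\<close>.\<close>

definition outer_prod :: "complex^'m \<Rightarrow> complex^'n \<Rightarrow> complex^'n^'m"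
  where "outer_prod v w = (\<chi> i j. v $ i * cnj (w $ j))"

text \<open>
  Of the standard equivalent descriptions of the pseudospectrum, the one by approximate eigenvectors
  serves as the definition.  The others are derived in \<open>pseudospectrum_iff_singular_value\<close>,
  \<open>pseudospectrum_iff_resolvent\<close> and \<open>pseudospectrum_iff_perturbation\<close>.
\<close>

definition pseudospectrum :: "real \<Rightarrow> complex^'n^'n \<Rightarrow> complex set"
  where "pseudospectrum \<epsilon> A = {z. \<exists>u. norm u = 1 \<and> (norm ((A - mat z) *v u))\<^sup>2 \<le> \<epsilon>\<^sup>2}"

definition smallest_singular_value :: "complex^'n^'n \<Rightarrow> real"
  where "smallest_singular_value M =
    (LEAST s. 0 \<le> s \<and> complex_of_real (s\<^sup>2) \<in> spectrum (cadjoint M ** M))"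


lemma mat_vector_mult: "mat z *v x = z *s (x :: complex^'n)"
  by (simp add: vec_eq_iff matrix_vector_mult_def mat_def if_distrib[where f = "\<lambda>a. a * _"]
      cong: if_cong)

lemma norm_vector_smult: "norm (c *s (x :: complex^'n)) = cmod c * norm x"
  by (simp add: norm_vec_def norm_mult L2_set_right_distrib)

lemma of_real_smult: "complex_of_real r *s (x :: complex^'n) = r *\<^sub>R x"
  by (simp add: vec_eq_iff scaleR_conv_of_real[where 'a = complex])

lemma matrix_vector_smult: "(A :: complex^'n^'m) *v (c *s x) = c *s (A *v x)"
  by (simp add: vec_eq_iff matrix_vector_mult_def sum_distrib_left mult_ac)

lemma matrix_vector_scaleR: "(A :: complex^'n^'m) *v (r *\<^sub>R x) = r *\<^sub>R (A *v x)"
  by (metis matrix_vector_smult of_real_smult)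

lemma matrix_scaleR_vector: "(r *\<^sub>R (A :: complex^'n^'m)) *v x = r *\<^sub>R (A *v x)"
  by (simp add: vec_eq_iff matrix_vector_mult_def scaleR_sum_right)

lemma bounded_linear_matrix_vector: "bounded_linear ((*v) (A :: complex^'n^'m))"
proof (intro linear_conv_bounded_linear[THEN iffD1] linearI)
qed (simp_all add: matrix_vector_right_distrib matrix_vector_scaleR)

lemma spectrum_iff_shift: "z \<in> spectrum A \<longleftrightarrow> (\<exists>x. x \<noteq> 0 \<and> (A - mat z) *v x = 0)"
  by (simp add: spectrum_def matrix_vector_mult_diff_rdistrib mat_vector_mult)

lemma inner_cadjoint: "x \<bullet> (cadjoint M *v y) = (M *v x) \<bullet> y" for M :: "complex^'n^'m"
proof -
  have "x \<bullet> (cadjoint M *v y) = (\<Sum>i\<in>UNIV. \<Sum>j\<in>UNIV. Re (x$i * (M$j$i * cnj (y$j))))"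
    by (simp add: inner_vec_def inner_complex_def matrix_vector_mult_def cadjoint_def
        sum_distrib_left flip: sum.distrib) (simp add: algebra_simps)
  also have "\<dots> = (\<Sum>j\<in>UNIV. \<Sum>i\<in>UNIV. Re (x$i * (M$j$i * cnj (y$j))))"
    by (rule sum.swap)
  also have "\<dots> = (M *v x) \<bullet> y"
    by (simp add: inner_vec_def inner_complex_def matrix_vector_mult_def
        sum_distrib_right flip: sum.distrib) (simp add: algebra_simps)
  finally show ?thesis .
qed

lemma outer_prod_vector: "outer_prod v w *v x = (\<Sum>j\<in>UNIV. cnj (w$j) * x$j) *s v"
  by (simp add: vec_eq_iff matrix_vector_mult_def outer_prod_def sum_distrib_left mult_ac)

lemma sum_cnj_mult_self: "(\<Sum>j\<in>UNIV. cnj (u$j) * u$j) = complex_of_real ((norm u)\<^sup>2)"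
proof -
  have "(norm u)\<^sup>2 = (\<Sum>j\<in>UNIV. (cmod (u$j))\<^sup>2)"
    by (simp add: norm_vec_def L2_set_def sum_nonneg)
  then show ?thesis
    by (simp add: complex_norm_square mult.commute flip: of_real_power)
qed

lemma norm_sum_cnj_mult_le: "cmod (\<Sum>j\<in>UNIV. cnj (w$j) * x$j) \<le> norm w * norm x"
proof -
  have "cmod (\<Sum>j\<in>UNIV. cnj (w$j) * x$j) \<le> (\<Sum>j\<in>UNIV. \<bar>cmod (w$j)\<bar> * \<bar>cmod (x$j)\<bar>)"
    by (rule order_trans[OF norm_sum]) (simp add: norm_mult)
  also have "\<dots> \<le> norm w * norm x"
    unfolding norm_vec_def by (rule L2_set_mult_ineq)
  finally show ?thesis .
qed

lemma pseudospectrum_iff: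
  assumes "0 \<le> \<epsilon>"
  shows "z \<in> pseudospectrum \<epsilon> A \<longleftrightarrow> (\<exists>u. norm u = 1 \<and> norm ((A - mat z) *v u) \<le> \<epsilon>)"
  using assms by (simp add: pseudospectrum_def power_mono_iff)

lemma pseudospectrum_iff_nonzero:
  assumes "0 \<le> \<epsilon>"
  shows "z \<in> pseudospectrum \<epsilon> A \<longleftrightarrow> (\<exists>u. u \<noteq> 0 \<and> norm ((A - mat z) *v u) \<le> \<epsilon> * norm u)"
proof
  assume "z \<in> pseudospectrum \<epsilon> A"
  then show "\<exists>u. u \<noteq> 0 \<and> norm ((A - mat z) *v u) \<le> \<epsilon> * norm u"
    unfolding pseudospectrum_iff[OF assms]
    by (metis mult.right_neutral norm_zero zero_neq_one)
next
  assume "\<exists>u. u \<noteq> 0 \<and> norm ((A - mat z) *v u) \<le> \<epsilon> * norm u"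
  then obtain u where u: "u \<noteq> 0" "norm ((A - mat z) *v u) \<le> \<epsilon> * norm u" by blast
  have "norm (u /\<^sub>R norm u) = 1" "norm ((A - mat z) *v (u /\<^sub>R norm u)) \<le> \<epsilon>"
    using u by (simp_all add: matrix_vector_scaleR field_simps)
  then show "z \<in> pseudospectrum \<epsilon> A"
    using assms pseudospectrum_iff by blast
qed

theorem pseudospectrum_iff_perturbation:
  fixes A :: "complex^'n^'n"
  assumes "0 \<le> \<epsilon>"
  shows "z \<in> pseudospectrum \<epsilon> A \<longleftrightarrow>
    (\<exists>E :: complex^'n^'n. onorm ((*v) E) \<le> 1 \<and> z \<in> spectrum (A + \<epsilon> *\<^sub>R E))"
proof
  assume "z \<in> pseudospectrum \<epsilon> A"
  then obtain u where u: "norm u = 1" "norm ((A - mat z) *v u) \<le> \<epsilon>"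
    using assms pseudospectrum_iff by blast
  define y where "y = ((A - mat z) *v u) /\<^sub>R \<epsilon>"
  have y: "norm y \<le> 1" "\<epsilon> *\<^sub>R y = (A - mat z) *v u"
    using u assms by (auto simp: y_def field_simps divide_simps)
  define E where "E = outer_prod (- y) u"
  have "norm (E *v x) \<le> 1 * norm x" for x
  proof -
    have "norm (E *v x) \<le> (norm u * norm x) * norm y"
      unfolding E_def outer_prod_vector norm_vector_smult norm_minus_cancel
      by (intro mult_right_mono norm_sum_cnj_mult_le) auto
    also have "\<dots> \<le> norm x"
      using y(1) u(1) by (simp add: mult_left_le)
    finally show ?thesis by simp
  qed
  then have "onorm ((*v) E) \<le> 1"
    by (rule onorm_le)
  moreover have "E *v u = - y"
    using u by (simp add: E_def outer_prod_vector sum_cnj_mult_self)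
  then have "(A + \<epsilon> *\<^sub>R E) *v u = z *s u"
    using y(2) by (simp add: matrix_vector_mult_add_rdistrib matrix_scaleR_vector
        matrix_vector_mult_diff_rdistrib mat_vector_mult)
  then have "z \<in> spectrum (A + \<epsilon> *\<^sub>R E)"
    using u unfolding spectrum_def by (intro CollectI exI[of _ u]) auto
  ultimately show "\<exists>E :: complex^'n^'n. onorm ((*v) E) \<le> 1 \<and> z \<in> spectrum (A + \<epsilon> *\<^sub>R E)"
    by blast
next
  assume "\<exists>E :: complex^'n^'n. onorm ((*v) E) \<le> 1 \<and> z \<in> spectrum (A + \<epsilon> *\<^sub>R E)"
  then obtain E :: "complex^'n^'n" and x
    where E: "onorm ((*v) E) \<le> 1" and x: "x \<noteq> 0" "(A + \<epsilon> *\<^sub>R E) *v x = z *s x"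
    unfolding spectrum_def by blast
  have "(A - mat z) *v x = - (\<epsilon> *\<^sub>R (E *v x))"
    using x(2) by (simp add: matrix_vector_mult_add_rdistrib matrix_scaleR_vector
        matrix_vector_mult_diff_rdistrib mat_vector_mult algebra_simps)
  moreover have "norm (E *v x) \<le> norm x"
    using onorm[OF bounded_linear_matrix_vector, of E x] mult_right_mono[OF E norm_ge_zero[of x]]
    by simp
  ultimately have "norm ((A - mat z) *v x) \<le> \<epsilon> * norm x"
    using assms by (simp add: mult_left_mono)
  then show "z \<in> pseudospectrum \<epsilon> A"
    using assms x(1) pseudospectrum_iff_nonzero by blast
qed

lemma notin_spectrum_iff_invertible: "z \<notin> spectrum A \<longleftrightarrow> invertible (A - mat z)"
  unfolding spectrum_iff_shift invertible_left_inverse matrix_left_invertible_ker by blast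

text \<open>
  With \<open>B = (A - z I)\<^sup>-\<^sup>1\<close>, the number \<open>u\<^sup>* B\<^sup>* B u\<close> is the real number \<open>(norm (B *v u))\<^sup>2\<close>.  In
  \<^typ>\<open>ereal\<close>, \<open>1 / 0 = \<infinity>\<close>.
\<close>

theorem pseudospectrum_iff_resolvent:
  fixes A :: "complex^'n^'n"
  assumes "0 \<le> \<epsilon>"
  shows "z \<in> pseudospectrum \<epsilon> A \<longleftrightarrow>
    z \<in> spectrum A \<or>
    z \<notin> spectrum A \<and>
      (\<exists>u. norm u = 1 \<and> ereal ((norm (matrix_inv (A - mat z) *v u))\<^sup>2) \<ge> 1 / ereal (\<epsilon>\<^sup>2))"
    (is "_ \<longleftrightarrow> ?S \<or> \<not> ?S \<and> ?R")
proof (cases "z \<in> spectrum A")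
  case True
  then obtain x where "x \<noteq> 0" "(A - mat z) *v x = 0"
    unfolding spectrum_iff_shift by blast
  then have "z \<in> pseudospectrum \<epsilon> A"
    using assms by (metis pseudospectrum_iff_nonzero norm_zero mult_nonneg_nonneg norm_ge_zero)
  with True show ?thesis by blast
next
  case False
  define M where "M = A - mat z"
  define B where "B = matrix_inv M"
  have inv: "invertible M"
    using False notin_spectrum_iff_invertible M_def by blast
  have "M ** B = mat 1 \<and> B ** M = mat 1"
    using someI_ex[OF inv[unfolded invertible_def]] unfolding B_def matrix_inv_def .
  then have BM: "B *v (M *v x) = x" and MB: "M *v (B *v x) = x" for x
    by (simp_all add: matrix_vector_mul_assoc)
  have "z \<in> pseudospectrum \<epsilon> A \<longleftrightarrow> ?R"
  proof (cases "\<epsilon> = 0")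
    case True
    then have "\<not> ?R" by (simp add: divide_ereal_def)
    moreover have "z \<notin> pseudospectrum \<epsilon> A"
      using True False by (auto simp: pseudospectrum_iff_nonzero spectrum_iff_shift)
    ultimately show ?thesis by blast
  next
    case pos: False
    have R: "?R \<longleftrightarrow> (\<exists>u. norm u = 1 \<and> 1 \<le> \<epsilon> * norm (B *v u))"
    proof -
      have "1 / ereal (\<epsilon>\<^sup>2) \<le> ereal ((norm (B *v u))\<^sup>2) \<longleftrightarrow> 1 \<le> \<epsilon> * norm (B *v u)" for u
      proof -
        have "1 / ereal (\<epsilon>\<^sup>2) = ereal (1 / \<epsilon>\<^sup>2)"
          using pos by (simp add: one_ereal_def)
        then have "1 / ereal (\<epsilon>\<^sup>2) \<le> ereal ((norm (B *v u))\<^sup>2) \<longleftrightarrow> 1\<^sup>2 \<le> (\<epsilon> * norm (B *v u))\<^sup>2"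
          using pos by (simp add: field_simps power_mult_distrib)
        also have "\<dots> \<longleftrightarrow> 1 \<le> \<epsilon> * norm (B *v u)"
          using assms by (subst power_mono_iff) auto
        finally show ?thesis .
      qed
      then show ?thesis unfolding B_def M_def by simp
    qed
    show ?thesis
    proof
      assume "z \<in> pseudospectrum \<epsilon> A"
      then obtain u where u: "norm u = 1" "norm (M *v u) \<le> \<epsilon>"
        using assms pseudospectrum_iff M_def by blast
      define w where "w = M *v u"
      have w: "w \<noteq> 0" "B *v w = u"
        using u BM[of u] by (auto simp: w_def)
      have "norm (w /\<^sub>R norm w) = 1" "1 \<le> \<epsilon> * norm (B *v (w /\<^sub>R norm w))"
        using w u by (simp_all add: matrix_vector_scaleR field_simps flip: w_def)
      then show ?R unfolding R by blast
    next
      assume ?R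
      then obtain u where u: "norm u = 1" "1 \<le> \<epsilon> * norm (B *v u)"
        unfolding R by blast
      then have "B *v u \<noteq> 0" "norm (M *v (B *v u)) \<le> \<epsilon> * norm (B *v u)"
        by (auto simp: MB)
      then show "z \<in> pseudospectrum \<epsilon> A"
        using assms pseudospectrum_iff_nonzero M_def by blast
    qed
  qed
  with False show ?thesis by blast
qed

lemma ex_smallest_singular_value:
  fixes M :: "complex^'n^'n"
  obtains s u where "0 \<le> s" "norm u = 1" "norm (M *v u) = s"
    "\<And>x. s * norm x \<le> norm (M *v x)" "smallest_singular_value M = s"
    "complex_of_real (s\<^sup>2) \<in> spectrum (cadjoint M ** M)"
proof -
  have "\<exists>u\<in>sphere 0 1. \<forall>x\<in>sphere 0 1. norm (M *v u) \<le> norm (M *v x)"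
    by (intro continuous_attains_inf continuous_intros
        linear_continuous_on[OF bounded_linear_matrix_vector]) auto
  then obtain u where u: "norm u = 1" and least: "\<And>x. norm x = 1 \<Longrightarrow> norm (M *v u) \<le> norm (M *v x)"
    by auto
  define s where "s = norm (M *v u)"
  have le: "s * norm x \<le> norm (M *v x)" for x
  proof (cases "x = 0")
    case False
    then have "s \<le> norm (M *v (x /\<^sub>R norm x))"
      unfolding s_def by (intro least) simp
    with False show ?thesis by (simp add: matrix_vector_scaleR field_simps)
  qed simp
  define K where "K x = (cadjoint M ** M) *v x - s\<^sup>2 *\<^sub>R x" for x
  have inner_K: "x \<bullet> K y = (M *v x) \<bullet> (M *v y) - s\<^sup>2 * (x \<bullet> y)" for x y
    by (simp add: K_def inner_diff_right inner_cadjoint flip: matrix_vector_mul_assoc)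
  have q_nonneg: "0 \<le> x \<bullet> K x" for x
  proof -
    have "(s * norm x)\<^sup>2 \<le> (norm (M *v x))\<^sup>2"
      by (intro power_mono le) (simp add: s_def)
    then show ?thesis
      by (simp add: inner_K power_mult_distrib flip: power2_norm_eq_inner)
  qed
  have q_u: "u \<bullet> K u = 0"
    by (simp add: inner_K s_def u flip: power2_norm_eq_inner)
  have "K u = 0"
  proof -
    define k where "k = K u"
    define c where "c = k \<bullet> K k"
    have expand: "(u + t *\<^sub>R k) \<bullet> K (u + t *\<^sub>R k) = 2 * t * (k \<bullet> k) + t\<^sup>2 * c" for t
    proof -
      have "K (u + t *\<^sub>R k) = k + t *\<^sub>R K k"
        by (simp add: K_def k_def matrix_vector_right_distrib matrix_vector_scaleR algebra_simps)
      moreover have "u \<bullet> K k = k \<bullet> k"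
        unfolding inner_K by (subst (2) k_def) (simp add: inner_K inner_commute)
      moreover have "u \<bullet> k = 0" using q_u k_def by simp
      ultimately show ?thesis
        by (simp add: c_def inner_add_left inner_add_right power2_eq_square algebra_simps)
    qed
    have c: "0 \<le> c" unfolding c_def by (rule q_nonneg)
    define t where "t = - (k \<bullet> k) / (c + 1)"
    have t: "t * (c + 1) = - (k \<bullet> k)"
      using c by (simp add: t_def)
    have "0 \<le> 2 * t * (k \<bullet> k) + t\<^sup>2 * c"
      using q_nonneg[of "u + t *\<^sub>R k"] unfolding expand .
    then have "0 \<le> (c + 1)\<^sup>2 * (2 * t * (k \<bullet> k) + t\<^sup>2 * c)"
      by simp
    also have "\<dots> = 2 * (k \<bullet> k) * (c + 1) * (t * (c + 1)) + c * (t * (c + 1))\<^sup>2"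
      by (simp add: algebra_simps power2_eq_square)
    also have "\<dots> = - ((k \<bullet> k)\<^sup>2 * (c + 2))"
      unfolding t by (simp add: algebra_simps power2_eq_square)
    finally have "(k \<bullet> k)\<^sup>2 * (c + 2) \<le> 0"
      by simp
    then have "(k \<bullet> k)\<^sup>2 \<le> 0"
      using c by (simp add: mult_le_0_iff)
    then show ?thesis by (simp add: k_def)
  qed
  then have eig: "complex_of_real (s\<^sup>2) \<in> spectrum (cadjoint M ** M)"
    using u unfolding spectrum_def K_def
    by (intro CollectI exI[of _ u]) (auto simp: of_real_smult simp del: of_real_power)
  have "smallest_singular_value M = s"
    unfolding smallest_singular_value_def
  proof (rule Least_equality)
    show "0 \<le> s \<and> complex_of_real (s\<^sup>2) \<in> spectrum (cadjoint M ** M)"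
      using eig by (simp add: s_def)
  next
    fix t assume t: "0 \<le> t \<and> complex_of_real (t\<^sup>2) \<in> spectrum (cadjoint M ** M)"
    then obtain x where x: "x \<noteq> 0" "(cadjoint M ** M) *v x = t\<^sup>2 *\<^sub>R x"
      unfolding spectrum_def mem_Collect_eq of_real_smult by (elim conjE exE)
    have "(M *v x) \<bullet> (M *v x) = x \<bullet> (t\<^sup>2 *\<^sub>R x)"
      unfolding x(2)[symmetric] matrix_vector_mul_assoc[symmetric] inner_cadjoint ..
    then have "(norm (M *v x))\<^sup>2 = (t * norm x)\<^sup>2"
      by (simp only: power2_norm_eq_inner power_mult_distrib inner_scaleR_right)
    then have "norm (M *v x) = t * norm x"
      by (rule power2_eq_imp_eq) (use t in auto)
    then show "s \<le> t"
      using le[of x] x(1) by simp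
  qed
  show ?thesis
    by (rule that[OF _ u _ le \<open>smallest_singular_value M = s\<close> eig]) (simp_all add: s_def)
qed

theorem pseudospectrum_iff_singular_value:
  assumes "0 \<le> \<epsilon>"
  shows "z \<in> pseudospectrum \<epsilon> A \<longleftrightarrow> smallest_singular_value (A - mat z) \<le> \<epsilon>"
proof -
  obtain s u where "norm u = 1" "norm ((A - mat z) *v u) = s"
    and le: "\<And>x. s * norm x \<le> norm ((A - mat z) *v x)"
    and s: "smallest_singular_value (A - mat z) = s"
    by (rule ex_smallest_singular_value[of "A - mat z"]) blast
  then show ?thesis
    using assms unfolding pseudospectrum_iff[OF assms] s
    by (metis mult.right_neutral order_trans)
qed

end

theory Submission
  imports Defs
begin

text \<open>
  Membership in the pseudospectrum and the two rank-one conditions are linked in a cycle.  A unit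
  vector \<open>u\<close> with residual \<open>r = A u - z u\<close> is an exact eigenvector of \<open>A - r u\<^sup>*\<close>, because
  \<open>u\<^sup>* u = 1\<close> makes the correction subtract precisely the residual
  (\<open>spectrum_residual_correction\<close>); so the residual condition holds with \<open>v = u\<close>.  Writing the
  residual in that condition as \<open>-\<epsilon> v\<^sub>2\<close> with \<open>v\<^sub>2\<close> in the unit ball gives the perturbation
  \<open>A + \<epsilon> v\<^sub>2 v\<^sub>1\<^sup>*\<close>.  Finally, an eigenvector \<open>x\<close> of this matrix for \<open>z\<close> satisfies
  \<open>(A - z I) x = -\<epsilon> (v\<^sub>1\<^sup>* x) v\<^sub>2\<close>, whose norm is at most \<open>\<epsilon> \<parallel>x\<parallel>\<close> by Cauchy-Schwarz, so \<open>x\<close> is an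
  approximate eigenvector of \<open>A\<close> (\<open>pseudospectrum_if_rank_one\<close>).
\<close>

lemma scaleR_outer_prod: "c *\<^sub>R outer_prod v w = outer_prod (c *\<^sub>R v) w"
  by (simp add: vec_eq_iff outer_prod_def)

lemma outer_prod_minus_left: "outer_prod (- v) w = - outer_prod v w"
  by (simp add: vec_eq_iff outer_prod_def)

text \<open>
  The correction subtracts \<open>\<parallel>u\<parallel>\<^sup>2\<close> times the residual from \<open>A u\<close>, so for a unit vector \<open>u\<close> only
  \<open>z u\<close> remains.
\<close>

lemma spectrum_residual_correction:
  fixes A :: "complex^'n^'n"
  assumes "norm u = 1"
  shows "z \<in> spectrum (A - outer_prod (A *v u - z *s u) u)"
proof -
  have "(A - outer_prod (A *v u - z *s u) u) *v u = z *s u"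
    using assms by (simp add: matrix_vector_mult_diff_rdistrib outer_prod_vector sum_cnj_mult_self)
  then show ?thesis
    using assms unfolding spectrum_def by (intro CollectI exI[of _ u]) auto
qed

text \<open>
  It is the eigenvector of the perturbed matrix, and not \<open>w\<close>, that serves as the approximate
  eigenvector of \<open>A\<close>.
\<close>

lemma pseudospectrum_if_rank_one:
  fixes A :: "complex^'n^'n"
  assumes "norm r \<le> \<epsilon>" "norm w \<le> 1" "z \<in> spectrum (A + outer_prod r w)"
  shows "z \<in> pseudospectrum \<epsilon> A"
proof -
  obtain x where x: "x \<noteq> 0" "(A + outer_prod r w) *v x = z *s x"
    using assms(3) unfolding spectrum_def by blast
  define c where "c = (\<Sum>j\<in>UNIV. cnj (w$j) * x$j)"
  have "(A - mat z) *v x + c *s r = 0"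
    using x(2) by (simp add: matrix_vector_mult_add_rdistrib matrix_vector_mult_diff_rdistrib
        mat_vector_mult outer_prod_vector c_def algebra_simps)
  then have "(A - mat z) *v x = - (c *s r)"
    by (simp add: eq_neg_iff_add_eq_0)
  then have "norm ((A - mat z) *v x) = cmod c * norm r"
    by (simp add: norm_vector_smult)
  also have "\<dots> \<le> norm x * \<epsilon>"
  proof (rule mult_mono)
    show "cmod c \<le> norm x"
      using norm_sum_cnj_mult_le[of w x] mult_right_mono[OF assms(2) norm_ge_zero[of x]]
      by (simp add: c_def)
  qed (use assms(1) in auto)
  finally have "norm ((A - mat z) *v x) \<le> \<epsilon> * norm x"
    by (simp add: mult.commute)
  moreover have "0 \<le> \<epsilon>"
    using assms(1) norm_ge_zero order_trans by blast
  ultimately show ?thesis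
    using x(1) pseudospectrum_iff_nonzero by blast
qed

theorem mainTheorem1:
  fixes A :: "complex^'n^'n" and \<epsilon> :: real and z :: complex
  assumes "\<epsilon> \<ge> 0"
  shows
    "(z \<in> pseudospectrum \<epsilon> A \<longleftrightarrow>
       (\<exists>v1 v2 :: complex^'n. norm v1 \<le> 1 \<and> norm v2 \<le> 1 \<and>
          z \<in> spectrum (A + \<epsilon> *\<^sub>R outer_prod v2 v1))) \<and>
     (z \<in> pseudospectrum \<epsilon> A \<longleftrightarrow>
       (\<exists>v :: complex^'n. norm v \<le> 1 \<and> norm (A *v v - z *s v) \<le> \<epsilon> \<and>
          z \<in> spectrum (A - outer_prod (A *v v - z *s v) v)))"
    (is "(?P \<longleftrightarrow> ?V) \<and> (?P \<longleftrightarrow> ?VI)")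
proof -
  have "?VI" if P: ?P
  proof -
    obtain u where "norm u = 1" "norm ((A - mat z) *v u) \<le> \<epsilon>"
      using P assms pseudospectrum_iff by blast
    then show ?thesis
      using spectrum_residual_correction[of u z A]
      by (intro exI[of _ u]) (simp add: matrix_vector_mult_diff_rdistrib mat_vector_mult)
  qed
  moreover have "?V" if VI: ?VI
  proof -
    obtain v where v: "norm v \<le> 1" "norm (A *v v - z *s v) \<le> \<epsilon>"
      "z \<in> spectrum (A - outer_prod (A *v v - z *s v) v)"
      using VI by blast
    define r where "r = A *v v - z *s v"
    have r: "norm r \<le> \<epsilon>"
      using v(2) by (simp add: r_def)
    \<comment> \<open>For \<open>\<epsilon> = 0\<close> the residual vanishes, and \<open>inverse 0 = 0\<close> makes \<open>y\<close> vanish as well.\<close>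
    define y where "y = - (r /\<^sub>R \<epsilon>)"
    have "norm y \<le> 1"
      using r assms by (simp add: y_def field_simps divide_simps)
    moreover have "\<epsilon> *\<^sub>R y = - r"
      using r by (cases "\<epsilon> = 0") (simp_all add: y_def)
    then have "A + \<epsilon> *\<^sub>R outer_prod y v = A - outer_prod r v"
      by (simp only: scaleR_outer_prod outer_prod_minus_left diff_conv_add_uminus)
    then have "z \<in> spectrum (A + \<epsilon> *\<^sub>R outer_prod y v)"
      using v(3) by (simp only: r_def)
    ultimately show ?thesis
      using v(1) by blast
  qed
  moreover have "?P" if V: ?V
  proof -
    obtain v1 v2 where v: "norm v1 \<le> 1" "norm v2 \<le> 1"
      "z \<in> spectrum (A + outer_prod (\<epsilon> *\<^sub>R v2) v1)"
      using V unfolding scaleR_outer_prod by blast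
    have "norm (\<epsilon> *\<^sub>R v2) \<le> \<epsilon>"
      using v(2) assms by (simp add: mult_left_le)
    then show ?thesis
      using v(1,3) by (rule pseudospectrum_if_rank_one)
  qed
  ultimately show ?thesis by blast
qed

end
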